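(* Let $\varepsilon>0$, $\beta\ge0$, $\Delta t>0$. Consider the fully discrete scheme for the isotropic Cahn–Hilliard equation $$\begin{aligned} U_i&=U^n+\Delta t\sum_{j=1}^s a_{ij}K_j,\qquad Q_i=Q^n+\Delta t\sum_{j=1}^s a_{ij}L_j,\qquad i=1,\dots,s,\\ K_i&=\Delta_h\mu_i,\qquad \mu_i=-\Delta_hU_i+2\varepsilon^{-2}U_i\odot Q_i+\beta\Delta_h^2U_i,\qquad L_i=U_i\odot K_i,\\ U^{n+1}&=U^n+\Delta t\sum_{i=1}^s b_iK_i,\qquad Q^{n+1}=Q^n+\Delta t\sum_{i=1}^s b_iL_i, \end{aligned}$$ where the coefficients satisfy $b_ia_{ij}+b_ja_{ji}-b_ib_j=0$ for $1\le i,j\le s$, initialized consistently by $Q^0=\frac12\bigl((U^0)^{\odot2}-\mathbf 1\bigr)$. Then the scheme satisfies the discrete energy-dissipation law $$\frac{E_{\mathrm{iso},h}(U^{n+1})-E_{\mathrm{iso},h}(U^n)}{\Delta t}=-\sum_{i=1}^s b_i\left(\|D_x\mu_i\|_h^2+\|\mu_iD_y^\top\|_h^2\right).$$ In particular, if $b_i\ge0$ for $i=1,\ldots,s$, then $E_{\mathrm{iso},h}(U^{n+1})\le E_{\mathrm{iso},h}(U^n)$.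
   Context: $\Omega=[a_x,b_x]\times[a_y,b_y]$ with periodic boundary conditions, $\Omega_h=\{(x_j,y_k):x_j=a_x+jh_x,\ y_k=a_y+kh_y\}$ is a uniform periodic grid with mesh sizes $h_x,h_y$, and $V_h$ is the space of real grid functions (matrices) $U=\{U_{jk}\}$ on $\Omega_h$. $D_x,D_y$ are the first-order Fourier pseudo-spectral differentiation matrices on the periodic grid (real and skew-symmetric), acting as $D_xU$ and $UD_y^\top$. The discrete Laplacian is $\Delta_hU=D_x^2U+U(D_y^\top)^2$. The discrete inner product is $(U,V)_h=h_xh_y\sum_{j,k}U_{jk}V_{jk}$ with norm $\|\cdot\|_h$. $\odot$ is the Hadamard (entrywise) product, $U^{\odot2}=U\odot U$, and $\mathbf 1$ is the grid function identically equal to $1$. All quantities $U^n,Q^n,U_i,Q_i,\mu_i,K_i,L_i$ belong to $V_h$. The original discrete energy is $$E_{\mathrm{iso},h}(U)=-\tfrac12(\Delta_hU,U)_h+\varepsilon^{-2}\Bigl\|\tfrac12\bigl(U^{\odot2}-\mathbf 1\bigr)\Bigr\|_h^2+\tfrac{\beta}{2}\|\Delta_hU\|_h^2 .$$ *)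

theory Defs
  imports "HOL-Analysis.Analysis"
begin

text \<open>
  A real grid function on a periodic grid with \<open>CARD('nx)\<close> times \<open>CARD('ny)\<close> nodes is a matrix
  \<open>U\<close> with entries \<open>U $ j $ k\<close>, where \<open>j\<close> indexes the \<open>x\<close>-direction and \<open>k\<close> the \<open>y\<close>-direction.
  On this type the library operations \<open>*\<close> and \<open>1\<close> are entrywise, so \<open>U * V\<close> is the Hadamard
  product and \<open>1\<close> is the grid function identically one; the matrix product is \<open>**\<close>.
\<close>
type_synonym ('nx, 'ny) grid_fun = "((real, 'ny) vec, 'nx) vec"

text \<open>The index type is linearly ordered; the rank of \<open>j\<close> is its number in \<open>0, \<dots>, CARD('n) - 1\<close>.\<close>
definition grid_point :: "real \<Rightarrow> real \<Rightarrow> 'n::{finite,linorder} \<Rightarrow> real"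
  where "grid_point a b j = a + real (card {i. i < j}) * ((b - a) / real CARD('n))"

text \<open>
  First-order Fourier pseudo-spectral differentiation on \<open>[a, b]\<close>: discrete Fourier transform on
  the \<open>N\<close> nodes, multiplication of mode \<open>l\<close> by \<open>\<i> \<mu> l\<close> with \<open>\<mu> = 2 \<pi> / (b - a)\<close>, inverse transform.
  Only the modes with \<open>\<bar>l\<bar> < N / 2\<close> contribute: for even \<open>N\<close> the multiplier of the
  unpaired mode \<open>N / 2\<close> is zero, as usual for the first derivative, which makes the matrix real.
\<close>
definition fourier_kernel :: "real \<Rightarrow> real \<Rightarrow> nat \<Rightarrow> real \<Rightarrow> complex"
  where "fourier_kernel a b N t =
    (let \<mu> = 2 * pi / (b - a); M = (int N - 1) div 2 in
      (\<Sum>l = -M..M. \<i> * of_real (\<mu> * of_int l) * exp (\<i> * of_real (\<mu> * of_int l * t))) / of_nat N)"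

definition fourier_diff :: "real \<Rightarrow> real \<Rightarrow> real^('n::{finite,linorder})^('n::{finite,linorder})"
  where "fourier_diff a b =
    (\<chi> j k. Re (fourier_kernel a b CARD('n) (grid_point a b j - grid_point a b k)))"

lemma cnj_fourier_kernel: "cnj (fourier_kernel a b N t) = fourier_kernel a b N t"
proof -
  define \<mu> where "\<mu> = 2 * pi / (b - a)"
  have "(\<Sum>l = -M..M. cnj (\<i> * of_real (\<mu> * of_int l) * exp (\<i> * of_real (\<mu> * of_int l * t))))
      = (\<Sum>l = -M..M. \<i> * of_real (\<mu> * of_int l) * exp (\<i> * of_real (\<mu> * of_int l * t)))" for M
    by (rule sum.reindex_bij_witness[where i = uminus and j = uminus]) (auto simp: exp_cnj)
  then show ?thesis
    by (simp only: fourier_kernel_def Let_def \<mu>_def[symmetric] complex_cnj_divide cnj_sum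
        complex_cnj_of_nat)
qed

lemma of_real_fourier_diff:
  "complex_of_real (fourier_diff a b $ j $ k) =
     fourier_kernel a b CARD('n) (grid_point a b j - grid_point a b (k :: 'n::{finite,linorder}))"
  using cnj_fourier_kernel[of a b "CARD('n)" "grid_point a b j - grid_point a b k"]
  by (simp add: fourier_diff_def complex_eq_iff)

lemma fourier_kernel_minus: "fourier_kernel a b N (- t) = - fourier_kernel a b N t"
proof -
  define \<mu> where "\<mu> = 2 * pi / (b - a)"
  have "(\<Sum>l = -M..M. \<i> * of_real (\<mu> * of_int l) * exp (\<i> * of_real (\<mu> * of_int l * - t)))
      = (\<Sum>l = -M..M. - (\<i> * of_real (\<mu> * of_int l) * exp (\<i> * of_real (\<mu> * of_int l * t))))" for M
    by (rule sum.reindex_bij_witness[where i = uminus and j = uminus]) auto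
  then show ?thesis
    by (simp only: fourier_kernel_def Let_def \<mu>_def[symmetric] sum_negf minus_divide_left)
qed

lemma transpose_fourier_diff:
  "transpose (fourier_diff a b :: real^('n::{finite,linorder})^('n::{finite,linorder})) = - fourier_diff a b"
proof -
  have "fourier_diff a b $ k $ j = - (fourier_diff a b $ j $ k)" for j k :: 'n
    using fourier_kernel_minus[of a b "CARD('n)" "grid_point a b j - grid_point a b k"]
    by (simp add: fourier_diff_def)
  then show ?thesis
    unfolding vec_eq_iff transpose_def by (metis vec_lambda_beta uminus_vec_def)
qed

definition laplacian_h ::
  "real^'nx^'nx \<Rightarrow> real^'ny^'ny \<Rightarrow> ('nx, 'ny) grid_fun \<Rightarrow> ('nx, 'ny) grid_fun"
  where "laplacian_h Dx Dy U = (Dx ** Dx) ** U + U ** (transpose Dy ** transpose Dy)"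

definition inner_h ::
  "real \<Rightarrow> real \<Rightarrow> ('nx::finite, 'ny::finite) grid_fun \<Rightarrow> ('nx, 'ny) grid_fun \<Rightarrow> real"
  where "inner_h hx hy U V = hx * hy * (\<Sum>j\<in>UNIV. \<Sum>k\<in>UNIV. U $ j $ k * V $ j $ k)"

definition norm_h :: "real \<Rightarrow> real \<Rightarrow> ('nx::finite, 'ny::finite) grid_fun \<Rightarrow> real"
  where "norm_h hx hy U = sqrt (inner_h hx hy U U)"

definition energy_iso_h ::
  "real \<Rightarrow> real \<Rightarrow> real^'nx^'nx \<Rightarrow> real^'ny^'ny \<Rightarrow> real \<Rightarrow> real \<Rightarrow> ('nx, 'ny) grid_fun \<Rightarrow> real"
  where "energy_iso_h hx hy Dx Dy \<epsilon> \<beta> U =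
    - (1 / 2) * inner_h hx hy (laplacian_h Dx Dy U) U
    + (1 / \<epsilon>\<^sup>2) * (norm_h hx hy ((1 / 2) *\<^sub>R (U * U - 1)))\<^sup>2
    + (\<beta> / 2) * (norm_h hx hy (laplacian_h Dx Dy U))\<^sup>2"

text \<open>
  One time step from \<open>(U, Q)\<close> to \<open>(U', Q')\<close>, with stage values indexed by \<open>1, \<dots>, s\<close>. The scheme is
  implicit in general, hence it is a relation; stage values with other indices are irrelevant.
\<close>
definition cahn_hilliard_rk_step ::
  "real^'nx^'nx \<Rightarrow> real^'ny^'ny \<Rightarrow> real \<Rightarrow> real \<Rightarrow> real \<Rightarrow>
   nat \<Rightarrow> (nat \<Rightarrow> nat \<Rightarrow> real) \<Rightarrow> (nat \<Rightarrow> real) \<Rightarrow>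
   ('nx, 'ny) grid_fun \<Rightarrow> ('nx, 'ny) grid_fun \<Rightarrow>
   (nat \<Rightarrow> ('nx, 'ny) grid_fun) \<Rightarrow> (nat \<Rightarrow> ('nx, 'ny) grid_fun) \<Rightarrow> (nat \<Rightarrow> ('nx, 'ny) grid_fun) \<Rightarrow>
   (nat \<Rightarrow> ('nx, 'ny) grid_fun) \<Rightarrow> (nat \<Rightarrow> ('nx, 'ny) grid_fun) \<Rightarrow>
   ('nx, 'ny) grid_fun \<Rightarrow> ('nx, 'ny) grid_fun \<Rightarrow> bool"
  where "cahn_hilliard_rk_step Dx Dy \<epsilon> \<beta> \<Delta>t s a b U Q Us Qs \<mu> K L U' Q' \<longleftrightarrow>
    (\<forall>i\<in>{1..s}.
      Us i = U + \<Delta>t *\<^sub>R (\<Sum>j = 1..s. a i j *\<^sub>R K j) \<and>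
      Qs i = Q + \<Delta>t *\<^sub>R (\<Sum>j = 1..s. a i j *\<^sub>R L j) \<and>
      K i = laplacian_h Dx Dy (\<mu> i) \<and>
      \<mu> i = - laplacian_h Dx Dy (Us i) + (2 / \<epsilon>\<^sup>2) *\<^sub>R (Us i * Qs i)
             + \<beta> *\<^sub>R laplacian_h Dx Dy (laplacian_h Dx Dy (Us i)) \<and>
      L i = Us i * K i) \<and>
    U' = U + \<Delta>t *\<^sub>R (\<Sum>i = 1..s. b i *\<^sub>R K i) \<and>
    Q' = Q + \<Delta>t *\<^sub>R (\<Sum>i = 1..s. b i *\<^sub>R L i)"

end

theory Submission
  imports Defs
begin

text \<open>
  With the auxiliary variable \<open>Q = 1/2 (U * U - 1)\<close> the quartic energy becomes a quadratic form in
  \<open>(U, Q)\<close>. The extended flow \<open>dU/dt = K\<close>, \<open>dQ/dt = U * K\<close> has \<open>Q - 1/2 (U * U)\<close> as a quadratic first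
  integral, and this ties \<open>Q\<close> to \<open>U\<close> for all times. A Runge-Kutta method whose coefficients satisfy
  \<open>b\<^sub>i a\<^sub>i\<^sub>j + b\<^sub>j a\<^sub>j\<^sub>i = b\<^sub>i b\<^sub>j\<close> treats quadratic forms exactly: by
  \<open>runge_kutta_quadratic_increment\<close>, the increment over one step is \<open>\<Delta>t\<close> times the \<open>b\<close>-weighted sum of the
  derivatives along the vector field at the stages, with no remainder.

  Applied to the entrywise product, this propagates the relation between \<open>Q\<close> and \<open>U\<close> from the initial
  data to every step (\<open>cahn_hilliard_rk_step_consistent\<close>), so that the quadratic energy agrees with
  the original one at the time levels, though not at the stages in general. Applied to the quadratic
  energy, it gives the increment \<open>\<Delta>t \<Sum> b\<^sub>i (\<mu>\<^sub>i, K\<^sub>i)\<^sub>h\<close>, because \<open>\<mu>\<^sub>i\<close> collects the derivative of that energy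
  along \<open>dQ = U * dU\<close> at the stage (\<open>cahn_hilliard_rk_step_energy\<close>). Finally \<open>K\<^sub>i = \<Delta>\<^sub>h \<mu>\<^sub>i\<close>, and since
  the differentiation matrices are skew-symmetric, summation by parts turns \<open>(\<mu>\<^sub>i, \<Delta>\<^sub>h \<mu>\<^sub>i)\<^sub>h\<close> into
  minus the squared norms of the two discrete partial derivatives.
\<close>

section \<open>Quadratic forms along Runge-Kutta steps\<close>

text \<open>
  Expanding \<open>B y' y'\<close> leaves a term linear in the slopes, evaluated at \<open>y\<close>, and one quadratic in
  them. Moving the base point of the linear term from \<open>y\<close> to the stages \<open>Y i\<close> produces a second
  quadratic term, and the condition on the coefficients makes the two cancel. The values of \<open>B\<close> may
  lie in a vector space, so that \<open>B\<close> can be the entrywise product as well as an inner product.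
\<close>
lemma runge_kutta_quadratic_increment:
  fixes B :: "'v::real_vector \<Rightarrow> 'v \<Rightarrow> 'w::real_vector"
  assumes bil: "bilinear B" and sym: "\<And>u v. B u v = B v u"
    and coeff: "\<And>i j. i \<in> I \<Longrightarrow> j \<in> I \<Longrightarrow> b i * a i j + b j * a j i - b i * b j = 0"
    and stage: "\<And>i. i \<in> I \<Longrightarrow> Y i = y + h *\<^sub>R (\<Sum>j\<in>I. a i j *\<^sub>R k j)"
    and step: "y' = y + h *\<^sub>R (\<Sum>i\<in>I. b i *\<^sub>R k i)"
  shows "B y' y' = B y y + (2 * h) *\<^sub>R (\<Sum>i\<in>I. b i *\<^sub>R B (Y i) (k i))"
proof -
  note lin = bilinear_ladd[OF bil] bilinear_radd[OF bil] bilinear_lmul[OF bil] bilinear_rmul[OF bil]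
  have suml: "B (\<Sum>i\<in>I. f i) v = (\<Sum>i\<in>I. B (f i) v)" for f :: "_ \<Rightarrow> 'v" and v
    using bil linear_sum[of "\<lambda>u. B u v" f I] by (simp add: bilinear_def)
  have sumr: "B v (\<Sum>i\<in>I. f i) = (\<Sum>i\<in>I. B v (f i))" for f :: "_ \<Rightarrow> 'v" and v
    using bil linear_sum[of "B v" f I] by (simp add: bilinear_def)
  \<comment> \<open>\<open>S\<close> is the linear term at the base point, \<open>A\<close> the correction from moving it to the stages, and
    \<open>C\<close> the quadratic term of the update.\<close>
  define S where "S = (\<Sum>i\<in>I. b i *\<^sub>R B y (k i))"
  define A where "A = (\<Sum>i\<in>I. \<Sum>j\<in>I. (b i * a i j) *\<^sub>R B (k i) (k j))"
  define C where "C = (\<Sum>i\<in>I. \<Sum>j\<in>I. (b i * b j) *\<^sub>R B (k i) (k j))"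
  have "A + A = C"
  proof -
    have "A = (\<Sum>i\<in>I. \<Sum>j\<in>I. (b j * a j i) *\<^sub>R B (k i) (k j))"
      unfolding A_def by (subst sum.swap) (simp add: sym)
    then have "A + A = (\<Sum>i\<in>I. \<Sum>j\<in>I. (b i * a i j + b j * a j i) *\<^sub>R B (k i) (k j))"
      by (simp add: A_def sum.distrib scaleR_add_left)
    also have "\<dots> = C"
      unfolding C_def using coeff by (intro sum.cong refl) (simp add: algebra_simps)
    finally show ?thesis .
  qed
  moreover have "(\<Sum>i\<in>I. b i *\<^sub>R B (Y i) (k i)) = S + h *\<^sub>R A"
  proof -
    have "b i *\<^sub>R B (Y i) (k i)
        = b i *\<^sub>R B y (k i) + h *\<^sub>R (\<Sum>j\<in>I. (b i * a i j) *\<^sub>R B (k i) (k j))" if "i \<in> I" for i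
    proof -
      have "B (Y i) (k i) = B y (k i) + h *\<^sub>R (\<Sum>j\<in>I. a i j *\<^sub>R B (k j) (k i))"
        by (simp only: stage[OF that] lin suml)
      then show ?thesis
        by (simp add: sym[of _ "k i"] scaleR_add_right scaleR_sum_right mult.left_commute)
    qed
    then show ?thesis
      by (simp add: S_def A_def sum.distrib scaleR_sum_right)
  qed
  moreover have "B y' y' = B y y + (2 * h) *\<^sub>R S + (h * h) *\<^sub>R C"
  proof -
    have "B y (\<Sum>i\<in>I. b i *\<^sub>R k i) = S"
      by (simp add: S_def sumr lin)
    moreover have "B (\<Sum>i\<in>I. b i *\<^sub>R k i) (\<Sum>i\<in>I. b i *\<^sub>R k i) = C"
      by (simp only: C_def suml) (simp add: sumr lin scaleR_sum_right mult.commute)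
    ultimately show ?thesis
      by (simp only: step lin sym[of "\<Sum>i\<in>I. b i *\<^sub>R k i" y])
        (simp add: scaleR_add_right algebra_simps flip: scaleR_2)
  qed
  ultimately show ?thesis
    by (simp add: scaleR_add_right scaleR_2 flip: \<open>A + A = C\<close> scaleR_scaleR)
qed

section \<open>Grid functions and the discrete Laplacian\<close>

lemma inner_h_eq_inner: "inner_h hx hy U V = hx * hy * (U \<bullet> V)"
  by (simp add: inner_h_def inner_vec_def)

lemma norm_h_squared: "0 \<le> hx * hy \<Longrightarrow> (norm_h hx hy U)\<^sup>2 = hx * hy * (U \<bullet> U)"
  by (simp add: norm_h_def inner_h_eq_inner)

lemma inner_hadamard: "(U * V) \<bullet> W = U \<bullet> (V * W)" for U V W :: "('nx::finite, 'ny::finite) grid_fun"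
  by (simp add: inner_vec_def mult.assoc)

lemma bilinear_inner: "bilinear (inner :: 'a::real_inner \<Rightarrow> 'a \<Rightarrow> real)"
  by (simp add: bilinear_def linear_iff inner_add_left inner_add_right)

lemma inner_matrix_mult_left: "(A ** U) \<bullet> V = U \<bullet> (transpose A ** V)"
  for A :: "real^'n^'m" and U :: "real^'k^'n"
proof -
  have "(A ** U) \<bullet> V = (\<Sum>i\<in>UNIV. \<Sum>k\<in>UNIV. \<Sum>j\<in>UNIV. A $ i $ j * U $ j $ k * V $ i $ k)"
    by (simp add: inner_vec_def matrix_matrix_mult_def sum_distrib_right)
  also have "\<dots> = (\<Sum>i\<in>UNIV. \<Sum>j\<in>UNIV. \<Sum>k\<in>UNIV. A $ i $ j * U $ j $ k * V $ i $ k)"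
    by (intro sum.cong refl sum.swap)
  also have "\<dots> = (\<Sum>j\<in>UNIV. \<Sum>i\<in>UNIV. \<Sum>k\<in>UNIV. A $ i $ j * U $ j $ k * V $ i $ k)"
    by (rule sum.swap)
  also have "\<dots> = (\<Sum>j\<in>UNIV. \<Sum>k\<in>UNIV. \<Sum>i\<in>UNIV. A $ i $ j * U $ j $ k * V $ i $ k)"
    by (intro sum.cong refl sum.swap)
  also have "\<dots> = U \<bullet> (transpose A ** V)"
    by (simp add: inner_vec_def matrix_matrix_mult_def transpose_def sum_distrib_left mult_ac)
  finally show ?thesis .
qed

lemma inner_transpose: "transpose U \<bullet> transpose V = U \<bullet> V" for U V :: "real^'n^'m"
  by (simp add: inner_vec_def transpose_def) (rule sum.swap)

lemma inner_matrix_mult_right: "(U ** A) \<bullet> V = U \<bullet> (V ** transpose A)"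
  for A :: "real^'k^'n" and U :: "real^'n^'m"
proof -
  have "(U ** A) \<bullet> V = (transpose A ** transpose U) \<bullet> transpose V"
    by (simp add: inner_transpose flip: matrix_transpose_mul)
  also have "\<dots> = transpose U \<bullet> (transpose (V ** transpose A))"
    by (simp add: inner_matrix_mult_left matrix_transpose_mul)
  finally show ?thesis
    by (simp add: inner_transpose)
qed

lemma linear_matrix_mult_left: "linear (\<lambda>U. A ** U)"
  for A :: "real^'n^'m"
  by (simp add: linear_iff matrix_matrix_mult_def vec_eq_iff algebra_simps sum.distrib sum_distrib_left)

lemma linear_matrix_mult_right: "linear (\<lambda>U. U ** A)"
  for A :: "real^'k^'n"
  by (simp add: linear_iff matrix_matrix_mult_def vec_eq_iff algebra_simps sum.distrib sum_distrib_left)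

lemma linear_laplacian_h: "linear (laplacian_h Dx Dy)"
  unfolding laplacian_h_def
  by (intro linear_compose_add linear_matrix_mult_left linear_matrix_mult_right)

lemma transpose_minus: "transpose (- A) = - transpose A" for A :: "real^'n^'m"
  by (simp add: transpose_def vec_eq_iff)

lemma matrix_mult_minus_left: "(- A) ** B = - (A ** B)" for A :: "real^'n^'m"
  by (simp add: matrix_matrix_mult_def vec_eq_iff sum_negf)

lemma matrix_mult_minus_right: "A ** (- B) = - (A ** B)" for A :: "real^'n^'m"
  by (simp add: matrix_matrix_mult_def vec_eq_iff sum_negf)

lemma laplacian_h_self_adjoint:
  assumes "transpose Dx = - Dx" and "transpose Dy = - Dy"
  shows "laplacian_h Dx Dy U \<bullet> V = U \<bullet> laplacian_h Dx Dy V"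
  unfolding laplacian_h_def inner_add_left inner_add_right
    inner_matrix_mult_left[of "Dx ** Dx"] inner_matrix_mult_right[of _ "transpose Dy ** transpose Dy"]
  by (simp add: matrix_transpose_mul assms matrix_mult_minus_left matrix_mult_minus_right
      transpose_minus)

text \<open>Summation by parts: one factor of each squared differentiation matrix changes sides.\<close>
lemma laplacian_h_dissipative:
  assumes "transpose Dx = - Dx" and "transpose Dy = - Dy"
  shows "V \<bullet> laplacian_h Dx Dy V
    = - ((Dx ** V) \<bullet> (Dx ** V) + (V ** transpose Dy) \<bullet> (V ** transpose Dy))"
proof -
  have "(Dx ** V) \<bullet> (Dx ** V) = - (V \<bullet> ((Dx ** Dx) ** V))"
    by (subst inner_matrix_mult_left)
      (simp add: assms matrix_mult_minus_left matrix_mul_assoc)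
  moreover have "(V ** transpose Dy) \<bullet> (V ** transpose Dy)
      = - (V \<bullet> (V ** (transpose Dy ** transpose Dy)))"
    by (subst inner_matrix_mult_right)
      (simp add: assms transpose_minus matrix_mult_minus_left matrix_mult_minus_right matrix_mul_assoc)
  ultimately show ?thesis
    by (simp add: laplacian_h_def inner_add_right)
qed

section \<open>The scheme\<close>

lemma cahn_hilliard_rk_stepD:
  assumes "cahn_hilliard_rk_step Dx Dy \<epsilon> \<beta> \<Delta>t s a b U Q Us Qs \<mu> K L U' Q'"
  shows "i \<in> {1..s} \<Longrightarrow> Us i = U + \<Delta>t *\<^sub>R (\<Sum>j = 1..s. a i j *\<^sub>R K j)"
    and "i \<in> {1..s} \<Longrightarrow> Qs i = Q + \<Delta>t *\<^sub>R (\<Sum>j = 1..s. a i j *\<^sub>R L j)"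
    and "i \<in> {1..s} \<Longrightarrow> K i = laplacian_h Dx Dy (\<mu> i)"
    and "i \<in> {1..s} \<Longrightarrow> \<mu> i = - laplacian_h Dx Dy (Us i) + (2 / \<epsilon>\<^sup>2) *\<^sub>R (Us i * Qs i)
      + \<beta> *\<^sub>R laplacian_h Dx Dy (laplacian_h Dx Dy (Us i))"
    and "i \<in> {1..s} \<Longrightarrow> L i = Us i * K i"
    and "U' = U + \<Delta>t *\<^sub>R (\<Sum>i = 1..s. b i *\<^sub>R K i)"
    and "Q' = Q + \<Delta>t *\<^sub>R (\<Sum>i = 1..s. b i *\<^sub>R L i)"
  using assms unfolding cahn_hilliard_rk_step_def by blast+

text \<open>
  \<open>Q\<close> is advanced with the slopes \<open>L i = Us i * K i\<close>, and exactness for the entrywise square says that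
  \<open>1/2 (U * U)\<close> advances by the same weighted sum.
\<close>
lemma cahn_hilliard_rk_step_consistent:
  assumes "cahn_hilliard_rk_step Dx Dy \<epsilon> \<beta> \<Delta>t s a b U Q Us Qs \<mu> K L U' Q'"
    and coeff: "\<And>i j. i \<in> {1..s} \<Longrightarrow> j \<in> {1..s} \<Longrightarrow> b i * a i j + b j * a j i - b i * b j = 0"
    and "Q = (1 / 2) *\<^sub>R (U * U - 1)"
  shows "Q' = (1 / 2) *\<^sub>R (U' * U' - 1)"
proof -
  note rk = cahn_hilliard_rk_stepD[OF assms(1)]
  have "U' * U' = U * U + (2 * \<Delta>t) *\<^sub>R (\<Sum>i = 1..s. b i *\<^sub>R (Us i * K i))"
    by (rule runge_kutta_quadratic_increment[OF bilinear_times mult.commute coeff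
          rk(1) rk(6)])
  moreover have "Q' = Q + \<Delta>t *\<^sub>R (\<Sum>i = 1..s. b i *\<^sub>R (Us i * K i))"
    using rk(7) rk(5) by simp
  ultimately show ?thesis
    by (simp add: assms(3) scaleR_add_right scaleR_diff_right)
qed

text \<open>
  On consistent data the quartic energy splits into a quadratic form in \<open>U\<close> and the squared norm of
  \<open>Q\<close>. Each has an exact increment over the step; the two increments combine to the pairing of \<open>\<mu> i\<close>
  with \<open>K i\<close>, because pairing \<open>Qs i\<close> with \<open>L i = Us i * K i\<close> amounts to pairing \<open>Us i * Qs i\<close> with \<open>K i\<close>.
\<close>
lemma cahn_hilliard_rk_step_energy:
  assumes skew: "transpose Dx = - Dx" "transpose Dy = - Dy"
    and h: "0 \<le> hx * hy"
    and rk: "cahn_hilliard_rk_step Dx Dy \<epsilon> \<beta> \<Delta>t s a b U Q Us Qs \<mu> K L U' Q'"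
    and coeff: "\<And>i j. i \<in> {1..s} \<Longrightarrow> j \<in> {1..s} \<Longrightarrow> b i * a i j + b j * a j i - b i * b j = 0"
    and cons: "Q = (1 / 2) *\<^sub>R (U * U - 1)"
  shows "energy_iso_h hx hy Dx Dy \<epsilon> \<beta> U' - energy_iso_h hx hy Dx Dy \<epsilon> \<beta> U
    = - \<Delta>t * (\<Sum>i = 1..s. b i * ((norm_h hx hy (Dx ** \<mu> i))\<^sup>2
                              + (norm_h hx hy (\<mu> i ** transpose Dy))\<^sup>2))"
proof -
  let ?\<Delta> = "laplacian_h Dx Dy"
  \<comment> \<open>The polar form of the part of the energy that depends on \<open>U\<close> without \<open>Q\<close>.\<close>
  define B where "B u v = - (1 / 2) * (?\<Delta> u \<bullet> v) + (\<beta> / 2) * (?\<Delta> u \<bullet> ?\<Delta> v)" for u v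
  note step = cahn_hilliard_rk_stepD[OF rk]
  have cons': "Q' = (1 / 2) *\<^sub>R (U' * U' - 1)"
    by (rule cahn_hilliard_rk_step_consistent[OF rk coeff cons])
  have energy: "energy_iso_h hx hy Dx Dy \<epsilon> \<beta> u = hx * hy * (B u u + (1 / \<epsilon>\<^sup>2) * (q \<bullet> q))"
    if "q = (1 / 2) *\<^sub>R (u * u - 1)" for u q
    unfolding energy_iso_h_def that[symmetric] norm_h_squared[OF h] inner_h_eq_inner B_def
    by (simp add: algebra_simps)
  have "bilinear B"
    unfolding B_def bilinear_def linear_iff
    by (simp add: linear_add[OF linear_laplacian_h] linear_scale[OF linear_laplacian_h]
        inner_add_left inner_add_right algebra_simps)
  moreover have "B u v = B v u" for u v
    using laplacian_h_self_adjoint[OF skew, of u v]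
    by (simp add: B_def inner_commute[of u "?\<Delta> v"] inner_commute[of "?\<Delta> u" "?\<Delta> v"]
        inner_commute[of v "?\<Delta> u"])
  ultimately have incU: "B U' U' = B U U + (2 * \<Delta>t) *\<^sub>R (\<Sum>i = 1..s. b i *\<^sub>R B (Us i) (K i))"
    by (rule runge_kutta_quadratic_increment[OF _ _ coeff step(1) step(6)])
  have incQ: "Q' \<bullet> Q' = Q \<bullet> Q + (2 * \<Delta>t) *\<^sub>R (\<Sum>i = 1..s. b i *\<^sub>R (Qs i \<bullet> L i))"
    by (rule runge_kutta_quadratic_increment[OF bilinear_inner inner_commute coeff step(2) step(7)])
  have chem: "2 * B (Us i) (K i) + (2 / \<epsilon>\<^sup>2) * (Qs i \<bullet> L i) = \<mu> i \<bullet> K i" if "i \<in> {1..s}" for i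
  proof -
    have "Qs i \<bullet> L i = (Us i * Qs i) \<bullet> K i"
      by (simp add: step(5)[OF that] mult.commute[of "Us i" "Qs i"] inner_hadamard)
    moreover have "?\<Delta> (Us i) \<bullet> ?\<Delta> (K i) = ?\<Delta> (?\<Delta> (Us i)) \<bullet> K i"
      by (simp add: laplacian_h_self_adjoint[OF skew])
    ultimately show ?thesis
      by (subst step(4)[OF that]) (simp add: B_def inner_add_left inner_diff_left)
  qed
  have "energy_iso_h hx hy Dx Dy \<epsilon> \<beta> U' - energy_iso_h hx hy Dx Dy \<epsilon> \<beta> U
      = hx * hy * \<Delta>t * (\<Sum>i = 1..s. b i * (2 * B (Us i) (K i) + (2 / \<epsilon>\<^sup>2) * (Qs i \<bullet> L i)))"
    unfolding energy[OF cons] energy[OF cons'] incU incQ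
    by (simp add: sum.distrib sum_distrib_left algebra_simps)
  also have "\<dots> = hx * hy * \<Delta>t * (\<Sum>i = 1..s. b i * (\<mu> i \<bullet> ?\<Delta> (\<mu> i)))"
    using chem step(3) by simp
  also have "\<dots> = - \<Delta>t * (\<Sum>i = 1..s. b i * ((norm_h hx hy (Dx ** \<mu> i))\<^sup>2
                              + (norm_h hx hy (\<mu> i ** transpose Dy))\<^sup>2))"
    by (simp add: laplacian_h_dissipative[OF skew] norm_h_squared[OF h] sum_distrib_left
        sum_negf[symmetric] algebra_simps)
  finally show ?thesis .
qed

theorem proposition3:
  fixes a\<^sub>x b\<^sub>x a\<^sub>y b\<^sub>y h\<^sub>x h\<^sub>y \<epsilon> \<beta> \<Delta>t :: real
    and D\<^sub>x :: "real^('nx::{finite,linorder})^('nx::{finite,linorder})"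
    and D\<^sub>y :: "real^('ny::{finite,linorder})^('ny::{finite,linorder})"
    and s n :: nat and a :: "nat \<Rightarrow> nat \<Rightarrow> real" and b :: "nat \<Rightarrow> real"
    and U Q :: "nat \<Rightarrow> ('nx, 'ny) grid_fun"
    and Us Qs \<mu> K L :: "nat \<Rightarrow> nat \<Rightarrow> ('nx, 'ny) grid_fun"
  assumes "a\<^sub>x < b\<^sub>x" and "a\<^sub>y < b\<^sub>y"
    and "h\<^sub>x = (b\<^sub>x - a\<^sub>x) / real CARD('nx)" and "h\<^sub>y = (b\<^sub>y - a\<^sub>y) / real CARD('ny)"
    and "D\<^sub>x = fourier_diff a\<^sub>x b\<^sub>x" and "D\<^sub>y = fourier_diff a\<^sub>y b\<^sub>y"
    and "\<epsilon> > 0" and "\<beta> \<ge> 0" and "\<Delta>t > 0"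
    and "\<And>i j. i \<in> {1..s} \<Longrightarrow> j \<in> {1..s} \<Longrightarrow> b i * a i j + b j * a j i - b i * b j = 0"
    and "Q 0 = (1 / 2) *\<^sub>R (U 0 * U 0 - 1)"
    and "\<And>m. m \<le> n \<Longrightarrow>
      cahn_hilliard_rk_step D\<^sub>x D\<^sub>y \<epsilon> \<beta> \<Delta>t s a b (U m) (Q m) (Us m) (Qs m) (\<mu> m) (K m) (L m)
        (U (Suc m)) (Q (Suc m))"
  shows "(energy_iso_h h\<^sub>x h\<^sub>y D\<^sub>x D\<^sub>y \<epsilon> \<beta> (U (Suc n)) - energy_iso_h h\<^sub>x h\<^sub>y D\<^sub>x D\<^sub>y \<epsilon> \<beta> (U n)) / \<Delta>t
      = - (\<Sum>i = 1..s. b i * ((norm_h h\<^sub>x h\<^sub>y (D\<^sub>x ** \<mu> n i))\<^sup>2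
                              + (norm_h h\<^sub>x h\<^sub>y (\<mu> n i ** transpose D\<^sub>y))\<^sup>2))
    \<and> ((\<forall>i\<in>{1..s}. b i \<ge> 0) \<longrightarrow>
        energy_iso_h h\<^sub>x h\<^sub>y D\<^sub>x D\<^sub>y \<epsilon> \<beta> (U (Suc n)) \<le> energy_iso_h h\<^sub>x h\<^sub>y D\<^sub>x D\<^sub>y \<epsilon> \<beta> (U n))"
proof -
  let ?E = "energy_iso_h h\<^sub>x h\<^sub>y D\<^sub>x D\<^sub>y \<epsilon> \<beta>"
  let ?G = "\<lambda>i. (norm_h h\<^sub>x h\<^sub>y (D\<^sub>x ** \<mu> n i))\<^sup>2 + (norm_h h\<^sub>x h\<^sub>y (\<mu> n i ** transpose D\<^sub>y))\<^sup>2"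
  have consistent: "Q m = (1 / 2) *\<^sub>R (U m * U m - 1)" if "m \<le> n" for m
    using that
  proof (induction m)
    case 0
    show ?case by (rule assms(11))
  next
    case (Suc m)
    then show ?case
      using cahn_hilliard_rk_step_consistent[OF assms(12)[of m] assms(10)] by simp
  qed
  have "transpose D\<^sub>x = - D\<^sub>x" "transpose D\<^sub>y = - D\<^sub>y" "0 \<le> h\<^sub>x * h\<^sub>y"
    using assms(1-6) by (simp_all add: transpose_fourier_diff)
  from cahn_hilliard_rk_step_energy[OF this assms(12)[OF order_refl] assms(10) consistent[OF order_refl]]
  have diff: "?E (U (Suc n)) - ?E (U n) = - \<Delta>t * (\<Sum>i = 1..s. b i * ?G i)" .
  have "?E (U (Suc n)) \<le> ?E (U n)" if "\<forall>i\<in>{1..s}. b i \<ge> 0"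
  proof -
    have "0 \<le> \<Delta>t * (\<Sum>i = 1..s. b i * ?G i)"
      using that \<open>\<Delta>t > 0\<close> by (intro mult_nonneg_nonneg sum_nonneg) auto
    then show ?thesis using diff by linarith
  qed
  then show ?thesis
    using diff \<open>\<Delta>t > 0\<close> by simp
qed

end
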